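(* Let $\mathcal{F}$ be a $q$-exponential family with hand enumerator $\mathcal{H}(x,y)$ and deck enumerator $\mathcal{D}(x)$. Then, as formal power series, \[ \mathcal{H}(x,y)=\exp\big(y\,\mathcal{D}(x)\big). \]
   Context: Fix a finite field $\mathbf{F}_q$. Let $\mathbf{F}_q^{(\mathbf{N})}$ be the vector space of infinite sequences over $\mathbf{F}_q$ with finitely many nonzero entries, with standard basis $e_1,e_2,\dots$, and let $E_n=\mathrm{span}(e_1,\dots,e_n)$. Fix an abstract set $P$ of "pictures". A $q$-card $Q(V,p)$ is a pair of a subspace $V\subset\mathbf{F}_q^{(\mathbf{N})}$ (label space) and a picture $p\in P$; its dimension is $\dim V$; it is standard if $V=E_{\dim V}$. A card $Q(V',p)$ is a relabeling of $Q(V,p)$ if $\dim V'=\dim V$. A $q$-deck of dimension $n$ is a finite set of standard cards all of dimension $n$ with pairwise different pictures. A $q$-exponential family $\mathcal{F}$ is a sequence of $q$-decks $\mathcal{D}_1,\mathcal{D}_2,\dots$ with $\mathcal{D}_n$ of dimension $n$ (possibly empty); let $d_n=|\mathcal{D}_n|$. A hand of $\mathcal{F}$ of dimension $n$ is a finite set of cards, each a relabeling of a card in some deck of $\mathcal{F}$, whose label spaces form a direct sum decomposition of $E_n$. Let $\gamma_n=|\mathrm{GL}_n(\mathbf{F}_q)|=\prod_{i=0}^{n-1}(q^n-q^i)$, $\gamma_0=1$. The hand enumerator is $\mathcal{H}(x,y)=\sum_{n,k\ge0}h(n,k)\frac{x^n}{\gamma_n}y^k$, where $h(n,k)$ is the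 number of hands of dimension $n$ with $k$ cards, with $h(0,0)=1$ and $h(n,0)=h(0,k)=0$ for $n,k>0$. The deck enumerator is $\mathcal{D}(x)=\sum_{n\ge1}\frac{d_n}{\gamma_n}x^n$. *)

theory Defs
  imports
    "HOL-Library.Poly_Mapping"
    "HOL-Library.FuncSet"
    "HOL-Library.Cardinality"
    "HOL-Computational_Algebra.Formal_Power_Series"
begin

section \<open>The space of finitely supported sequences\<close>

text \<open>
  A finite field is a type \<open>'a :: {finite, field}\<close>, with \<open>q = CARD('a)\<close>.  The finitely
  supported sequences are \<open>nat \<Rightarrow>\<^sub>0 'a\<close>; positions are counted from 0, so
  \<open>Poly_Mapping.single i 1\<close> is the basis vector usually written \<open>e\<close> with index \<open>i + 1\<close>.
\<close>

type_synonym 'a fseq = "nat \<Rightarrow>\<^sub>0 'a"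

definition fseq_scale :: "'a::field \<Rightarrow> 'a fseq \<Rightarrow> 'a fseq" where
  "fseq_scale c v = Poly_Mapping.map ((*) c) v"

lemma lookup_fseq_scale [simp]:
  "Poly_Mapping.lookup (fseq_scale c v) i = c * Poly_Mapping.lookup v i"
  by (simp add: fseq_scale_def Poly_Mapping.map.rep_eq when_def)

interpretation fseq: vector_space "fseq_scale :: 'a::field \<Rightarrow> 'a fseq \<Rightarrow> 'a fseq"
  by unfold_locales (auto intro!: poly_mapping_eqI simp: lookup_add algebra_simps)

definition std_space :: "nat \<Rightarrow> 'a::field fseq set" where
  "std_space n = fseq.span ((\<lambda>i. Poly_Mapping.single i 1) ` {..<n})"

definition finite_dim_subspace :: "'a::field fseq set \<Rightarrow> bool" where
  "finite_dim_subspace V \<longleftrightarrow> fseq.subspace V \<and> (\<exists>B. finite B \<and> fseq.span B = V)"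

text \<open>
  \<open>W\<close> is the (internal) direct sum of the family \<open>V\<close> indexed by \<open>I\<close>: every element of \<open>W\<close> is
  a sum of elements of the members in exactly one way, and all such sums lie in \<open>W\<close>.
\<close>

definition direct_sum_decomp :: "'i set \<Rightarrow> ('i \<Rightarrow> 'a::field fseq set) \<Rightarrow> 'a fseq set \<Rightarrow> bool" where
  "direct_sum_decomp I V W \<longleftrightarrow>
     finite I \<and> (\<forall>i\<in>I. fseq.subspace (V i)) \<and>
     bij_betw (\<lambda>f. \<Sum>i\<in>I. f i) (\<Pi>\<^sub>E i\<in>I. V i) W"


section \<open>Cards, decks and families\<close>

type_synonym ('a, 'p) card_pair = "'a fseq set \<times> 'p"

abbreviation label :: "('a, 'p) card_pair \<Rightarrow> 'a fseq set" where
  "label \<equiv> fst"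

abbreviation picture :: "('a, 'p) card_pair \<Rightarrow> 'p" where
  "picture \<equiv> snd"

text \<open>
  Label spaces are required to be finite-dimensional because \<open>fseq.dim\<close> is 0 on
  infinite-dimensional subspaces.
\<close>

definition is_card :: "('a::field, 'p) card_pair \<Rightarrow> bool" where
  "is_card c \<longleftrightarrow> finite_dim_subspace (label c)"

definition card_dim :: "('a::field, 'p) card_pair \<Rightarrow> nat" where
  "card_dim c = fseq.dim (label c)"

definition standard_card :: "('a::field, 'p) card_pair \<Rightarrow> bool" where
  "standard_card c \<longleftrightarrow> is_card c \<and> label c = std_space (card_dim c)"

definition relabeling :: "('a::field, 'p) card_pair \<Rightarrow> ('a, 'p) card_pair \<Rightarrow> bool" where
  "relabeling c' c \<longleftrightarrow>
     is_card c' \<and> is_card c \<and> picture c' = picture c \<and> card_dim c' = card_dim c"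

definition q_deck :: "nat \<Rightarrow> ('a::field, 'p) card_pair set \<Rightarrow> bool" where
  "q_deck n D \<longleftrightarrow>
     finite D \<and> (\<forall>c\<in>D. standard_card c \<and> card_dim c = n) \<and> inj_on picture D"

text \<open>Decks are indexed by positive integers; the value of a family at 0 is never used.\<close>

definition q_exponential_family :: "(nat \<Rightarrow> ('a::field, 'p) card_pair set) \<Rightarrow> bool" where
  "q_exponential_family F \<longleftrightarrow> (\<forall>n\<ge>1. q_deck n (F n))"

text \<open>
  The direct sum is that of the family of label spaces indexed by the cards themselves, so two
  different cards of a hand cannot share a nonzero label space.
\<close>

definition is_hand ::
  "(nat \<Rightarrow> ('a::field, 'p) card_pair set) \<Rightarrow> nat \<Rightarrow> ('a, 'p) card_pair set \<Rightarrow> bool" where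
  "is_hand F n H \<longleftrightarrow>
     finite H \<and>
     (\<forall>c'\<in>H. \<exists>m\<ge>1. \<exists>c\<in>F m. relabeling c' c) \<and>
     direct_sum_decomp H label (std_space n)"

definition hand_count :: "(nat \<Rightarrow> ('a::field, 'p) card_pair set) \<Rightarrow> nat \<Rightarrow> nat \<Rightarrow> nat" where
  "hand_count F n k = card {H. is_hand F n H \<and> card H = k}"


section \<open>Enumerators\<close>

text \<open>The order of the general linear group of degree \<open>n\<close> over a field with \<open>q\<close> elements.\<close>

definition GL_order :: "nat \<Rightarrow> nat \<Rightarrow> nat" where
  "GL_order q n = (\<Prod>i<n. q ^ n - q ^ i)"

definition deck_enumerator ::
  "(nat \<Rightarrow> ('a::{finite, field}, 'p) card_pair set) \<Rightarrow> rat fps" where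
  "deck_enumerator F =
     Abs_fps (\<lambda>n. if n = 0 then 0 else of_nat (card (F n)) / of_nat (GL_order CARD('a) n))"

text \<open>
  Bivariate series live in \<open>\<rat>[[x]][[y]]\<close>, i.e. \<open>rat fps fps\<close> with \<open>x\<close> the inner and \<open>y\<close> the
  outer variable: the coefficient of \<open>x\<^sup>n y\<^sup>k\<close> in \<open>G\<close> is \<open>fps_nth (fps_nth G k) n\<close>.
\<close>

definition hand_enumerator ::
  "(nat \<Rightarrow> ('a::{finite, field}, 'p) card_pair set) \<Rightarrow> rat fps fps" where
  "hand_enumerator F =
     Abs_fps (\<lambda>k. Abs_fps (\<lambda>n. of_nat (hand_count F n k) / of_nat (GL_order CARD('a) n)))"

text \<open>
  The exponential of a series with vanishing constant term.  The library's \<open>fps_exp\<close> needs a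
  field of coefficients, which \<open>rat fps\<close> is not, so its coefficients are embedded as constants.
\<close>

definition bivariate_exp :: "rat fps fps \<Rightarrow> rat fps fps" where
  "bivariate_exp G = fps_compose (Abs_fps (\<lambda>k. fps_const (fps_nth (fps_exp 1) k))) G"


section \<open>The conventions for empty hands\<close>

lemma std_space_0: "std_space 0 = ({0} :: 'a::field fseq set)"
  by (simp add: std_space_def)

lemma hand_count_0_0: "hand_count F 0 0 = 1"
proof -
  have "is_hand F 0 {}"
    by (simp add: is_hand_def direct_sum_decomp_def std_space_0 bij_betw_def)
  then have "{H. is_hand F 0 H \<and> card H = 0} = {{}}"
    by (auto simp: is_hand_def)
  then show ?thesis
    by (simp add: hand_count_def)
qed

lemma hand_count_no_cards:
  fixes F :: "nat \<Rightarrow> ('a::field, 'p) card_pair set"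
  assumes "n > 0"
  shows "hand_count F n 0 = 0"
proof -
  have "\<not> is_hand F n {}"
  proof
    assume "is_hand F n {}"
    then have "std_space n = ({0} :: 'a fseq set)"
      by (simp add: is_hand_def direct_sum_decomp_def bij_betw_def)
    moreover have "Poly_Mapping.single 0 1 \<in> (std_space n :: 'a fseq set)"
      unfolding std_space_def using assms by (intro fseq.span_base imageI) simp
    ultimately show False
      by (metis singletonD single_zero lookup_single_eq zero_neq_one lookup_zero)
  qed
  then have "{H. is_hand F n H \<and> card H = 0} = {}"
    by (auto simp: is_hand_def)
  then show ?thesis
    by (simp only: hand_count_def card.empty)
qed

lemma direct_sum_decomp_member_subset:
  assumes "direct_sum_decomp I V W" and "i \<in> I"
  shows "V i \<subseteq> W"
proof
  fix v assume v: "v \<in> V i"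
  let ?f = "\<lambda>j\<in>I. if j = i then v else 0"
  have "?f \<in> (\<Pi>\<^sub>E j\<in>I. V j)"
    using assms v fseq.subspace_0 by (fastforce simp: direct_sum_decomp_def)
  then have "(\<Sum>j\<in>I. ?f j) \<in> W"
    using assms bij_betwE unfolding direct_sum_decomp_def by blast
  moreover have "(\<Sum>j\<in>I. ?f j) = v"
    using assms by (simp add: direct_sum_decomp_def)
  ultimately show "v \<in> W" by simp
qed

lemma hand_count_dim_0:
  fixes F :: "nat \<Rightarrow> ('a::field, 'p) card_pair set"
  assumes "q_exponential_family F" and "k > 0"
  shows "hand_count F 0 k = 0"
proof -
  have "H = {}" if hand: "is_hand F 0 H" for H
  proof (rule ccontr)
    assume "H \<noteq> {}"
    then obtain c' where c': "c' \<in> H" by blast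
    then obtain m c where m: "m \<ge> 1" "c \<in> F m" "relabeling c' c"
      using hand unfolding is_hand_def by blast
    have "card_dim c = m"
      using assms m by (auto simp: q_exponential_family_def q_deck_def)
    then have dim: "fseq.dim (label c') = m"
      using m by (simp add: relabeling_def card_dim_def)
    have "label c' \<subseteq> {0}"
      using hand c' direct_sum_decomp_member_subset std_space_0
      unfolding is_hand_def by metis
    then have "fseq.dim (label c') = 0"
      using fseq.dim_le_card[of "label c'" "{}"] by simp
    then show False using dim m by simp
  qed
  then have "{H. is_hand F 0 H \<and> card H = k} = {}"
    using assms(2) by fastforce
  then show ?thesis
    by (simp only: hand_count_def card.empty)
qed

end

(*
  Every hand with k cards can be ordered in k! ways.  Split off the first card of an ordered
  hand of a space W: this decomposes W as V (+) U with V the label of that card and the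
  other cards forming an ordered hand of U.  Concatenating ordered bases of V and U gives
  each ordered basis of W exactly once, so W has gamma_n / (gamma_m gamma_{n-m}) such
  decompositions with dim V = m, where n = dim W.  Hence, divided by gamma_n, the numbers of
  ordered hands satisfy the convolution recursion of the coefficients of D(x)^k.
*)
theory Submission
  imports Defs "HOL-Combinatorics.Multiset_Permutations"
begin

section \<open>Ordered bases\<close>

text \<open>Bases are lists so that a basis of a direct sum can be cut into bases of the summands,
  and so that their number is exactly \<open>GL_order\<close>.\<close>

definition ordered_bases :: "'a::field fseq set \<Rightarrow> 'a fseq list set" where
  "ordered_bases W = {xs. distinct xs \<and> fseq.independent (set xs) \<and> fseq.span (set xs) = W}"

lemma length_ordered_basis:
  assumes "xs \<in> ordered_bases W"
  shows "length xs = fseq.dim W"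
proof -
  have "fseq.dim W = card (set xs)"
    using assms fseq.dim_eq_card[of "set xs" W]
    by (auto simp: ordered_bases_def fseq.span_span)
  with assms show ?thesis
    by (simp add: ordered_bases_def distinct_card)
qed

text \<open>A finite spanning set contains a maximal independent subset, which still spans; listing
  it gives an ordered basis.\<close>

lemma finite_dim_subspace_iff_ordered_bases:
  "finite_dim_subspace W \<longleftrightarrow> ordered_bases W \<noteq> {}"
proof
  assume "finite_dim_subspace W"
  then obtain B where B: "finite B" "fseq.span B = W"
    by (auto simp: finite_dim_subspace_def)
  obtain C where C: "C \<subseteq> B" "fseq.independent C" "B \<subseteq> fseq.span C"
    using fseq.maximal_independent_subset[of B] by blast
  have "fseq.span C = W"
    using B C by (metis fseq.span_mono fseq.span_minimal fseq.subspace_span subset_antisym)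
  moreover obtain xs where "set xs = C" "distinct xs"
    using finite_distinct_list B C finite_subset by metis
  ultimately show "ordered_bases W \<noteq> {}"
    using C by (auto simp: ordered_bases_def)
next
  assume "ordered_bases W \<noteq> {}"
  then obtain xs where "fseq.span (set xs) = W"
    by (auto simp: ordered_bases_def)
  then show "finite_dim_subspace W"
    unfolding finite_dim_subspace_def by (metis List.finite_set fseq.subspace_span)
qed

section \<open>Sizes of subspaces and the number of ordered bases\<close>

text \<open>If \<open>a\<close> lies outside the span of \<open>B\<close>, each vector of the
  enlarged span is \<open>fseq_scale k a + v\<close> for exactly one scalar \<open>k\<close> and one
  \<open>v\<close> in the old span. So every new basis vector multiplies the size by
  \<open>CARD('a)\<close>.\<close>

lemma finite_card_span_independent:
  fixes B :: "'a::{finite, field} fseq set"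
  assumes "finite B" "fseq.independent B"
  shows "finite (fseq.span B) \<and> card (fseq.span B) = CARD('a) ^ card B"
  using assms
proof (induction B)
  case empty
  then show ?case by simp
next
  case (insert a B)
  have a: "a \<notin> fseq.span B" and B: "fseq.independent B"
    using insert by (auto simp: fseq.independent_insert)
  let ?f = "\<lambda>(k, v). fseq_scale k a + v"
  have "bij_betw ?f (UNIV \<times> fseq.span B) (fseq.span (insert a B))"
    unfolding bij_betw_def
  proof
    show "inj_on ?f (UNIV \<times> fseq.span B)"
    proof (rule inj_onI, clarify)
      fix k l :: 'a and v w
      assume vw: "v \<in> fseq.span B" "w \<in> fseq.span B"
        and eq: "fseq_scale k a + v = fseq_scale l a + w"
      have "fseq_scale (k - l) a = w - v"
        using eq by (simp add: fseq.scale_left_diff_distrib algebra_simps)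
      then have *: "fseq_scale (k - l) a \<in> fseq.span B"
        using vw by (simp add: fseq.span_diff)
      have "k = l"
      proof (rule ccontr)
        assume "k \<noteq> l"
        then have "fseq_scale (inverse (k - l)) (fseq_scale (k - l) a) = a"
          by simp
        then show False
          using fseq.span_scale[OF *] a by metis
      qed
      then show "k = l \<and> v = w" using eq by simp
    qed
    show "?f ` (UNIV \<times> fseq.span B) = fseq.span (insert a B)"
    proof (intro set_eqI iffI)
      fix x assume "x \<in> fseq.span (insert a B)"
      then obtain k where "x - fseq_scale k a \<in> fseq.span B"
        by (auto simp: fseq.span_insert)
      then have "(k, x - fseq_scale k a) \<in> UNIV \<times> fseq.span B" by simp
      moreover have "x = ?f (k, x - fseq_scale k a)" by simp
      ultimately show "x \<in> ?f ` (UNIV \<times> fseq.span B)" by (rule rev_image_eqI)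
    next
      fix x assume "x \<in> ?f ` (UNIV \<times> fseq.span B)"
      then show "x \<in> fseq.span (insert a B)"
        using fseq.span_mono[OF subset_insertI, of B a]
        by (auto intro!: fseq.span_add fseq.span_scale intro: fseq.span_base)
    qed
  qed
  moreover have "finite (UNIV \<times> fseq.span B :: ('a \<times> _) set)"
    using insert.IH B by simp
  ultimately show ?case
    using insert B bij_betw_finite bij_betw_same_card[symmetric]
    by (fastforce simp: card_cartesian_product)
qed

lemma finite_card_fin_dim:
  fixes W :: "'a::{finite, field} fseq set"
  assumes "finite_dim_subspace W"
  shows "finite W" "card W = CARD('a) ^ fseq.dim W"
proof -
  obtain xs where xs: "xs \<in> ordered_bases W"
    using assms finite_dim_subspace_iff_ordered_bases by blast
  then have "fseq.independent (set xs)" "fseq.span (set xs) = W"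
    by (auto simp: ordered_bases_def)
  moreover have "card (set xs) = fseq.dim W"
    using length_ordered_basis[OF xs] xs by (simp add: ordered_bases_def distinct_card)
  ultimately show "finite W" "card W = CARD('a) ^ fseq.dim W"
    using finite_card_span_independent[of "set xs"] by auto
qed

text \<open>An independent list of length \<open>fseq.dim W\<close> in \<open>W\<close> spans a
  subspace with as many elements as the finite set \<open>W\<close>, hence all of \<open>W\<close>.
  Without the spanning condition the lists can be counted entry by entry.\<close>

lemma ordered_bases_eq:
  fixes W :: "'a::{finite, field} fseq set"
  assumes "finite_dim_subspace W"
  shows "ordered_bases W =
    {xs. length xs = fseq.dim W \<and> set xs \<subseteq> W \<and> distinct xs \<and> fseq.independent (set xs)}"
proof (intro set_eqI iffI; clarify)
  fix xs assume "xs \<in> ordered_bases W"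
  then show "length xs = fseq.dim W \<and> set xs \<subseteq> W \<and> distinct xs \<and> fseq.independent (set xs)"
    using length_ordered_basis by (auto simp: ordered_bases_def fseq.span_base)
next
  fix xs assume xs: "length xs = fseq.dim W" "set xs \<subseteq> W" "distinct xs"
    "fseq.independent (set xs)"
  have "fseq.span (set xs) \<subseteq> W"
    using assms xs unfolding finite_dim_subspace_def by (metis fseq.span_minimal)
  moreover have "card (fseq.span (set xs)) = card W"
    using finite_card_span_independent[of "set xs"] finite_card_fin_dim[OF assms] xs
    by (simp add: distinct_card)
  ultimately have "fseq.span (set xs) = W"
    using card_subset_eq finite_card_fin_dim[OF assms] by blast
  then show "xs \<in> ordered_bases W"
    using xs by (simp add: ordered_bases_def)
qed

text \<open>An independent list of length \<open>k\<close> extends at its head by exactly the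
  vectors of \<open>W\<close> outside its span, and that span has \<open>CARD('a) ^ k\<close>
  elements. Beyond the dimension of \<open>W\<close> there are no such lists, and the product
  contains a zero factor.\<close>

lemma card_independent_lists:
  fixes W :: "'a::{finite, field} fseq set"
  assumes "finite W" "fseq.subspace W"
  shows "card {xs. length xs = k \<and> set xs \<subseteq> W \<and> distinct xs \<and> fseq.independent (set xs)}
    = (\<Prod>i<k. card W - CARD('a) ^ i)"
proof (induction k)
  case 0
  have "{xs. length xs = 0 \<and> set xs \<subseteq> W \<and> distinct xs \<and> fseq.independent (set xs)} = {[]}"
    by (auto simp: fseq.independent_empty)
  then show ?case by (simp only:) simp
next
  case (Suc k)
  let ?L = "\<lambda>k. {xs. length xs = k \<and> set xs \<subseteq> W \<and> distinct xs \<and> fseq.independent (set xs)}"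
  let ?S = "SIGMA xs:?L k. W - fseq.span (set xs)"
  have fin: "finite (?L k)"
    by (rule finite_subset[OF _ finite_lists_length_eq[OF assms(1), of k]]) auto
  have eq: "?L (Suc k) = (\<lambda>(xs, x). x # xs) ` ?S"
  proof (intro set_eqI iffI)
    fix ys assume "ys \<in> ?L (Suc k)"
    then obtain x xs where "ys = x # xs" "length xs = k" "set xs \<subseteq> W" "distinct xs" "x \<in> W"
      "x \<notin> set xs" "fseq.independent (insert x (set xs))"
      by (auto simp: length_Suc_conv)
    then show "ys \<in> (\<lambda>(xs, x). x # xs) ` ?S"
      by (intro image_eqI[of _ _ "(xs, x)"]) (auto simp: fseq.independent_insert)
  next
    fix ys assume "ys \<in> (\<lambda>(xs, x). x # xs) ` ?S"
    then obtain x xs where x: "ys = x # xs" "xs \<in> ?L k" "x \<in> W" "x \<notin> fseq.span (set xs)"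
      by auto
    moreover from this have "x \<notin> set xs"
      using fseq.span_base by blast
    ultimately show "ys \<in> ?L (Suc k)"
      by (simp add: fseq.independent_insert)
  qed
  have diff: "card (W - fseq.span (set xs)) = card W - CARD('a) ^ k" if "xs \<in> ?L k" for xs
  proof -
    have "fseq.span (set xs) \<subseteq> W"
      using that assms by (intro fseq.span_minimal) auto
    then show ?thesis
      using that finite_card_span_independent[of "set xs"]
      by (simp add: card_Diff_subset distinct_card)
  qed
  have "card (?L (Suc k)) = card ?S"
    unfolding eq by (rule card_image) (auto simp: inj_on_def)
  also have "\<dots> = (\<Sum>xs\<in>?L k. card (W - fseq.span (set xs)))"
    using fin assms by (intro card_SigmaI) auto
  also have "\<dots> = (\<Sum>xs\<in>?L k. card W - CARD('a) ^ k)"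
    using diff by (rule sum.cong[OF refl])
  also have "\<dots> = card (?L k) * (card W - CARD('a) ^ k)"
    by simp
  finally show ?case
    using Suc by simp
qed

lemma card_ordered_bases:
  fixes W :: "'a::{finite, field} fseq set"
  assumes "finite_dim_subspace W"
  shows "card (ordered_bases W) = GL_order CARD('a) (fseq.dim W)"
  unfolding ordered_bases_eq[OF assms] GL_order_def
  using card_independent_lists[of W "fseq.dim W"] finite_card_fin_dim[OF assms] assms
  by (simp add: finite_dim_subspace_def)

lemma GL_order_pos: "GL_order CARD('a::{finite, field}) n > 0"
proof -
  have "card {0, 1 :: 'a} \<le> CARD('a)"
    by (rule card_mono) auto
  then show ?thesis
    by (auto simp: GL_order_def intro!: prod_pos)
qed

lemma finite_ordered_bases:
  fixes W :: "'a::{finite, field} fseq set"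
  assumes "finite_dim_subspace W"
  shows "finite (ordered_bases W)"
\<comment> \<open>\<open>card\<close> is 0 on infinite sets, so a positive cardinality proves
  finiteness.\<close>
proof (rule card_ge_0_finite)
  show "card (ordered_bases W) > 0"
    unfolding card_ordered_bases[OF assms] by (rule GL_order_pos)
qed


section \<open>Decompositions into two summands\<close>

text \<open>The pairs are ordered: \<open>V\<close> will be the label of the first card and
  \<open>U\<close> the space decomposed by the remaining cards.\<close>

definition splittings :: "'a::field fseq set \<Rightarrow> ('a fseq set \<times> 'a fseq set) set" where
  "splittings W = {(V, U). fseq.subspace V \<and> fseq.subspace U \<and>
     V \<inter> U = {0} \<and> W = (\<lambda>(v, u). v + u) ` (V \<times> U)}"

lemma splittings_subset:
  assumes "(V, U) \<in> splittings W"
  shows "V \<subseteq> W" "U \<subseteq> W"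
proof -
  have "0 \<in> V" "0 \<in> U"
    using assms by (auto simp: splittings_def fseq.subspace_0)
  then show "V \<subseteq> W" "U \<subseteq> W"
    using assms by (force simp: splittings_def image_iff)+
qed

text \<open>Over a finite field \<open>W\<close> is a finite set, so \<open>V\<close> is a finite
  spanning set of itself.\<close>

lemma finite_dim_subspace_mono:
  fixes W :: "'a::{finite, field} fseq set"
  assumes "finite_dim_subspace W" "V \<subseteq> W" "fseq.subspace V"
  shows "finite_dim_subspace V"
proof -
  have "finite V"
    using assms finite_card_fin_dim(1) finite_subset by blast
  moreover have "fseq.span V = V"
    using assms(3) by (simp add: fseq.span_eq_iff)
  ultimately show ?thesis
    using assms(3) unfolding finite_dim_subspace_def by blast
qed

lemma finite_splittings:
  fixes W :: "'a::{finite, field} fseq set"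
  assumes "finite_dim_subspace W"
  shows "finite (splittings W)"
proof (rule finite_subset)
  show "splittings W \<subseteq> Pow W \<times> Pow W"
    using splittings_subset by (metis PowI SigmaI subrelI)
  show "finite (Pow W \<times> Pow W)"
    using finite_card_fin_dim(1)[OF assms] by simp
qed

section \<open>Bases of the summands and bases of the whole space\<close>

text \<open>Vectors of \<open>V\<close> are put one by one in front of a basis of \<open>U\<close>.
  If a new \<open>z\<close> were \<open>v + u\<close> with \<open>v\<close> in the span of its
  predecessors and \<open>u\<close> in \<open>U\<close>, then \<open>u = z - v\<close> would lie in
  both \<open>V\<close> and \<open>U\<close>, so \<open>u\<close> would be 0 and \<open>z\<close>
  would depend on its predecessors.\<close>

lemma append_mem_ordered_bases:
  assumes "(V, U) \<in> splittings W" "xs \<in> ordered_bases V" "ys \<in> ordered_bases U"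
  shows "xs @ ys \<in> ordered_bases W"
proof -
  have xs: "distinct xs" "fseq.independent (set xs)" "fseq.span (set xs) = V"
    and ys: "distinct ys" "fseq.independent (set ys)" "fseq.span (set ys) = U"
    using assms by (auto simp: ordered_bases_def)
  have W: "fseq.span (set xs \<union> set ys) = W"
    using assms(1) xs ys by (auto simp: fseq.span_Un splittings_def)
  \<comment> \<open>The induction needs arbitrary independent lists in \<open>V\<close>, since the
    tail of a basis of \<open>V\<close> is no longer a basis of \<open>V\<close>.\<close>
  have *: "distinct (zs @ ys) \<and> fseq.independent (set (zs @ ys))"
    if "distinct zs" "fseq.independent (set zs)" "set zs \<subseteq> V" for zs
    using that
  proof (induction zs)
    case Nil
    then show ?case using ys by simp
  next
    case (Cons z zs)
    have z: "z \<notin> fseq.span (set zs)" and zs: "fseq.independent (set zs)"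
      using Cons.prems by (auto simp: fseq.independent_insert)
    have "z \<notin> fseq.span (set zs \<union> set ys)"
    proof
      assume "z \<in> fseq.span (set zs \<union> set ys)"
      then obtain v u where vu: "z = v + u" "v \<in> fseq.span (set zs)" "u \<in> U"
        using ys by (auto simp: fseq.span_Un)
      have sV: "fseq.subspace V"
        using assms(1) by (simp add: splittings_def)
      have "fseq.span (set zs) \<subseteq> V"
        using Cons.prems sV by (intro fseq.span_minimal) auto
      then have "z - v \<in> V"
        using Cons.prems vu(2) by (intro fseq.subspace_diff[OF sV]) auto
      moreover have "z - v = u" using vu by simp
      ultimately have "u \<in> V \<inter> U" using vu by simp
      then have "u = 0" using assms(1) by (auto simp: splittings_def)
      then show False using vu z by simp
    qed
    then show ?case
      using Cons zs by (auto simp: fseq.independent_insert fseq.span_base)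
  qed
  have "set xs \<subseteq> V" using xs fseq.span_superset by auto
  then show ?thesis
    using * xs W by (simp add: ordered_bases_def)
qed

text \<open>Trivial intersection follows by counting: addition maps the product of the two spans
  onto \<open>W\<close>, and both sets have the same finite size, so it is injective. A common
  vector \<open>x\<close> gives \<open>(x, 0)\<close> and \<open>(0, x)\<close> with equal image,
  hence \<open>x = 0\<close>.\<close>

lemma ordered_bases_appendD:
  fixes W :: "'a::{finite, field} fseq set"
  assumes "xs @ ys \<in> ordered_bases W"
  shows "(fseq.span (set xs), fseq.span (set ys)) \<in> splittings W"
    and "xs \<in> ordered_bases (fseq.span (set xs))"
    and "ys \<in> ordered_bases (fseq.span (set ys))"
proof -
  have d: "distinct xs" "distinct ys" "set xs \<inter> set ys = {}"
    and ind: "fseq.independent (set xs \<union> set ys)"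
    and W: "W = fseq.span (set xs \<union> set ys)"
    using assms by (auto simp: ordered_bases_def)
  have ix: "fseq.independent (set xs)" and iy: "fseq.independent (set ys)"
    using fseq.independent_mono[OF ind] by auto
  have "fseq.span (set xs) \<inter> fseq.span (set ys) = {0}"
  proof -
    let ?P = "fseq.span (set xs) \<times> fseq.span (set ys)"
    let ?f = "\<lambda>(v, u). v + u"
    have "?f ` ?P = W"
      by (auto simp: W fseq.span_Un)
    moreover have "card W = card ?P"
      unfolding W card_cartesian_product
      using finite_card_span_independent[OF _ ix] finite_card_span_independent[OF _ iy]
        finite_card_span_independent[OF _ ind] d
      by (simp add: card_Un_disjoint power_add)
    moreover have "finite ?P"
      using finite_card_span_independent ix iy by blast
    ultimately have inj: "inj_on ?f ?P"
      using eq_card_imp_inj_on by metis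
    have "x = 0" if "x \<in> fseq.span (set xs)" "x \<in> fseq.span (set ys)" for x
      using inj_onD[OF inj, of "(x, 0)" "(0, x)"] that fseq.span_zero by auto
    then show ?thesis
      using fseq.span_zero by auto
  qed
  then show "(fseq.span (set xs), fseq.span (set ys)) \<in> splittings W"
    by (auto simp: splittings_def W fseq.span_Un fseq.subspace_span)
  show "xs \<in> ordered_bases (fseq.span (set xs))" "ys \<in> ordered_bases (fseq.span (set ys))"
    using d ix iy by (auto simp: ordered_bases_def)
qed


text \<open>A basis of \<open>V\<close> followed by a basis of \<open>U\<close> is a basis of
  \<open>W\<close>, so the lengths add up.\<close>

lemma dim_splitting:
  fixes W :: "'a::{finite, field} fseq set"
  assumes "finite_dim_subspace W" "(V, U) \<in> splittings W"
  shows "finite_dim_subspace V" "finite_dim_subspace U"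
    "fseq.dim V + fseq.dim U = fseq.dim W"
proof -
  have "fseq.subspace V" "fseq.subspace U"
    using assms(2) by (auto simp: splittings_def)
  then show V: "finite_dim_subspace V" and U: "finite_dim_subspace U"
    using finite_dim_subspace_mono[OF assms(1)] splittings_subset[OF assms(2)] by blast+
  obtain xs ys where *: "xs \<in> ordered_bases V" "ys \<in> ordered_bases U"
    using V U finite_dim_subspace_iff_ordered_bases by blast
  show "fseq.dim V + fseq.dim U = fseq.dim W"
    using length_ordered_basis[OF append_mem_ordered_bases[OF assms(2) *]]
    by (simp add: length_ordered_basis[OF *(1)] length_ordered_basis[OF *(2)])
qed

text \<open>Cutting an ordered basis of \<open>W\<close> after \<open>m\<close> entries yields a
  splitting together with an ordered basis of each summand, and concatenation inverts this. Counting
  ordered bases of \<open>W\<close> in both ways gives the identity, kept in product form to avoid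
  division of naturals.\<close>

lemma card_splittings:
  fixes W :: "'a::{finite, field} fseq set"
  assumes W: "finite_dim_subspace W" and m: "m \<le> fseq.dim W"
  shows "card {(V, U) \<in> splittings W. fseq.dim V = m} *
      (GL_order CARD('a) m * GL_order CARD('a) (fseq.dim W - m))
    = GL_order CARD('a) (fseq.dim W)"
proof -
  let ?S = "{(V, U) \<in> splittings W. fseq.dim V = m}"
  let ?T = "SIGMA VU:?S. ordered_bases (fst VU) \<times> ordered_bases (snd VU)"
  have fin: "finite ?S"
    using finite_splittings[OF W] by (rule rev_finite_subset) auto
  have "bij_betw (\<lambda>(_, xs, ys). xs @ ys) ?T (ordered_bases W)"
  proof (rule bij_betw_byWitness[where f' =
        "\<lambda>zs. ((fseq.span (set (take m zs)), fseq.span (set (drop m zs))), take m zs, drop m zs)"])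
    show "\<forall>t\<in>?T. (\<lambda>zs. ((fseq.span (set (take m zs)), fseq.span (set (drop m zs))),
        take m zs, drop m zs)) ((\<lambda>(_, xs, ys). xs @ ys) t) = t"
    proof
      fix t assume "t \<in> ?T"
      then obtain V U xs ys where t: "t = ((V, U), xs, ys)" and "fseq.dim V = m"
        and bases: "xs \<in> ordered_bases V" "ys \<in> ordered_bases U"
        by auto
      then have "length xs = m"
        using length_ordered_basis by blast
      then show "(\<lambda>zs. ((fseq.span (set (take m zs)), fseq.span (set (drop m zs))),
          take m zs, drop m zs)) ((\<lambda>(_, xs, ys). xs @ ys) t) = t"
        using bases by (simp add: t ordered_bases_def)
    qed
    show "(\<lambda>(_, xs, ys). xs @ ys) ` ?T \<subseteq> ordered_bases W"
      using append_mem_ordered_bases by auto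
    show "(\<lambda>zs. ((fseq.span (set (take m zs)), fseq.span (set (drop m zs))),
        take m zs, drop m zs)) ` ordered_bases W \<subseteq> ?T"
    proof (rule image_subsetI)
      fix zs assume zs: "zs \<in> ordered_bases W"
      then have *: "take m zs @ drop m zs \<in> ordered_bases W" by simp
      have "length (take m zs) = m"
        using length_ordered_basis[OF zs] m by simp
      then have "fseq.dim (fseq.span (set (take m zs))) = m"
        using length_ordered_basis[OF ordered_bases_appendD(2)[OF *]] by simp
      then show "((fseq.span (set (take m zs)), fseq.span (set (drop m zs))),
          take m zs, drop m zs) \<in> ?T"
        using ordered_bases_appendD[OF *] by simp
    qed
  qed simp
  then have "card (ordered_bases W) = card ?T"
    by (simp add: bij_betw_same_card)
  also have "\<dots> = (\<Sum>VU\<in>?S. card (ordered_bases (fst VU) \<times> ordered_bases (snd VU)))"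
    using fin dim_splitting[OF W] by (intro card_SigmaI) (auto intro!: finite_ordered_bases)
  also have "\<dots> = (\<Sum>VU\<in>?S. GL_order CARD('a) m * GL_order CARD('a) (fseq.dim W - m))"
  proof (rule sum.cong[OF refl], clarify)
    fix V U assume VU: "(V, U) \<in> splittings W" and dV: "m = fseq.dim V"
    show "card (ordered_bases (fst (V, U)) \<times> ordered_bases (snd (V, U)))
      = GL_order CARD('a) (fseq.dim V) * GL_order CARD('a) (fseq.dim W - fseq.dim V)"
      using dim_splitting[OF W VU]
      by (simp add: card_cartesian_product card_ordered_bases flip: dim_splitting(3)[OF W VU])
  qed
  finally show ?thesis
    by (simp add: card_ordered_bases[OF W])
qed

section \<open>Direct sums of families, one member at a time\<close>

text \<open>A choice function on \<open>insert i I\<close> is a value at \<open>i\<close> together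
  with a choice function on \<open>I\<close>. The only possible \<open>U\<close> is the set of all
  sums over \<open>I\<close>; injectivity of the full summation map then amounts to injectivity of
  the one over \<open>I\<close> together with \<open>V i \<inter> U = {0}\<close>.\<close>

lemma direct_sum_decomp_insert:
  fixes V :: "'i \<Rightarrow> 'a::field fseq set"
  assumes i: "i \<notin> I"
  shows "direct_sum_decomp (insert i I) V W \<longleftrightarrow>
    (\<exists>U. direct_sum_decomp I V U \<and> (V i, U) \<in> splittings W)"
\<comment> \<open>If the index set is infinite or some member is not a subspace, both sides are
  false.\<close>
proof (cases "finite I \<and> (\<forall>j\<in>insert i I. fseq.subspace (V j))")
  case False
  then show ?thesis
    by (auto simp: direct_sum_decomp_def splittings_def)
next
  case True
  then have fin: "finite I" and sub: "\<And>j. j \<in> I \<Longrightarrow> fseq.subspace (V j)"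
    and sub_i: "fseq.subspace (V i)" by auto
  let ?s = "\<lambda>f. \<Sum>j\<in>I. f j"
  let ?P = "\<Pi>\<^sub>E j\<in>I. V j"
  let ?U = "?s ` ?P"
  have zero: "(\<lambda>j\<in>I. 0) \<in> ?P" "?s (\<lambda>j\<in>I. 0) = 0"
    using sub by (auto intro: fseq.subspace_0)
  have subU: "fseq.subspace ?U"
  proof (rule fseq.subspaceI)
    show "0 \<in> ?U" using zero by (metis image_eqI)
  next
    fix x y assume "x \<in> ?U" "y \<in> ?U"
    then obtain f g where fg: "f \<in> ?P" "x = ?s f" "g \<in> ?P" "y = ?s g" by blast
    have "(\<lambda>j\<in>I. f j + g j) \<in> ?P"
      using fg sub by (auto intro!: fseq.subspace_add)
    moreover have "x + y = ?s (\<lambda>j\<in>I. f j + g j)"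
      using fg by (simp add: sum.distrib)
    ultimately show "x + y \<in> ?U" by blast
  next
    fix c x assume "x \<in> ?U"
    then obtain f where f: "f \<in> ?P" "x = ?s f" by blast
    have "(\<lambda>j\<in>I. fseq_scale c (f j)) \<in> ?P"
      using f sub by (auto intro!: fseq.subspace_scale)
    moreover have "fseq_scale c x = ?s (\<lambda>j\<in>I. fseq_scale c (f j))"
      using f by (simp add: fseq.scale_sum_right)
    ultimately show "fseq_scale c x \<in> ?U" by blast
  qed
  have "bij_betw (\<lambda>(y, g). g(i := y)) (V i \<times> ?P) (\<Pi>\<^sub>E j\<in>insert i I. V j)"
    unfolding bij_betw_def PiE_insert_eq using inj_combinator[OF i] by blast
  then have "bij_betw (\<lambda>f. \<Sum>j\<in>insert i I. f j) (\<Pi>\<^sub>E j\<in>insert i I. V j) W \<longleftrightarrow>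
      bij_betw ((\<lambda>f. \<Sum>j\<in>insert i I. f j) \<circ> (\<lambda>(y, g). g(i := y))) (V i \<times> ?P) W"
    by (rule bij_betw_comp_iff)
  also have "(\<lambda>f. \<Sum>j\<in>insert i I. f j) \<circ> (\<lambda>(y, g). g(i := y)) =
      (\<lambda>(y :: 'a fseq, g). y + ?s g)"
  proof -
    have "(\<Sum>j\<in>I. if j = i then y else g j) = ?s g" for y and g :: "'i \<Rightarrow> 'a fseq"
      using i by (intro sum.cong) auto
    then show ?thesis
      using i fin by (simp add: fun_eq_iff)
  qed
  finally have left: "direct_sum_decomp (insert i I) V W \<longleftrightarrow>
      bij_betw (\<lambda>(y, g). y + ?s g) (V i \<times> ?P) W"
    using True by (simp add: direct_sum_decomp_def)
  have img: "(\<lambda>(y, g). y + ?s g) ` (V i \<times> ?P) = (\<lambda>(v, u). v + u) ` (V i \<times> ?U)"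
  proof -
    have "V i \<times> ?U = map_prod id ?s ` (V i \<times> ?P)"
      by (simp add: map_prod_surj_on)
    then show ?thesis
      by (simp add: image_image case_prod_unfold)
  qed
  show ?thesis
  proof
    assume "direct_sum_decomp (insert i I) V W"
    then have inj: "inj_on (\<lambda>(y, g). y + ?s g) (V i \<times> ?P)"
      and W: "W = (\<lambda>(v, u). v + u) ` (V i \<times> ?U)"
      unfolding left bij_betw_def img by auto
    have "inj_on ?s ?P"
    proof (rule inj_onI)
      fix f g assume "f \<in> ?P" "g \<in> ?P" "?s f = ?s g"
      then show "f = g"
        using inj_onD[OF inj, of "(0, f)" "(0, g)"] fseq.subspace_0[OF sub_i] by simp
    qed
    then have "direct_sum_decomp I V ?U"
      using fin sub by (simp add: direct_sum_decomp_def bij_betw_def)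
    moreover have "V i \<inter> ?U \<subseteq> {0}"
    proof clarify
      fix f assume "?s f \<in> V i" "f \<in> ?P"
      \<comment> \<open>The pairs \<open>(?s f, 0)\<close> and \<open>(0, f)\<close> have the same
        total, so injectivity forces their first components to agree.\<close>
      then show "?s f = 0"
        using inj_onD[OF inj, of "(?s f, \<lambda>j\<in>I. 0)" "(0, f)"] zero fseq.subspace_0[OF sub_i]
        by simp
    qed
    then have "V i \<inter> ?U = {0}"
      using fseq.subspace_0[OF sub_i] fseq.subspace_0[OF subU] by blast
    ultimately show "\<exists>U. direct_sum_decomp I V U \<and> (V i, U) \<in> splittings W"
      using W subU sub_i unfolding splittings_def by blast
  next
    assume "\<exists>U. direct_sum_decomp I V U \<and> (V i, U) \<in> splittings W"
    then have inj: "inj_on ?s ?P" and int: "V i \<inter> ?U = {0}"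
      and W: "W = (\<lambda>(v, u). v + u) ` (V i \<times> ?U)"
      by (auto simp: direct_sum_decomp_def bij_betw_def splittings_def)
    have "inj_on (\<lambda>(y, g). y + ?s g) (V i \<times> ?P)"
    proof (rule inj_onI, clarify)
      fix y z f g
      assume *: "y \<in> V i" "z \<in> V i" "f \<in> ?P" "g \<in> ?P" "y + ?s f = z + ?s g"
      then have "y - z = ?s g - ?s f" by (simp add: algebra_simps)
      moreover have "y - z \<in> V i"
        using * sub_i fseq.subspace_diff by blast
      moreover have "?s g - ?s f \<in> ?U"
        using * subU fseq.subspace_diff by blast
      ultimately have "y - z \<in> V i \<inter> ?U" by (metis IntI)
      then have "y - z = 0" unfolding int by simp
      then show "y = z \<and> f = g"
        using * inj_onD[OF inj] by simp
    qed
    then show "direct_sum_decomp (insert i I) V W"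
      unfolding left bij_betw_def img using W by simp
  qed
qed

text \<open>\<open>W\<close> is the image of the summation map. Thus the remaining cards of an
  ordered hand determine the complement they decompose.\<close>

lemma direct_sum_decomp_unique:
  assumes "direct_sum_decomp I V W" "direct_sum_decomp I V W'"
  shows "W = W'"
  using assms by (auto simp: direct_sum_decomp_def bij_betw_def)


section \<open>Ordered hands\<close>

text \<open>A family is unconstrained at 0, so dimension 0 is given no pictures, matching the zero
  constant term of the deck enumerator.\<close>

definition pictures :: "(nat \<Rightarrow> ('a::field, 'p) card_pair set) \<Rightarrow> nat \<Rightarrow> 'p set" where
  "pictures F n = (if n = 0 then {} else picture ` F n)"

text \<open>An intrinsic form of being a relabeling of a deck card: only the label's dimension and
  the picture matter, so the first card of a hand can be chosen as a pair of independent data once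
  its label is known.\<close>

definition family_card :: "(nat \<Rightarrow> ('a::field, 'p) card_pair set) \<Rightarrow> ('a, 'p) card_pair \<Rightarrow> bool"
  where "family_card F c \<longleftrightarrow>
    finite_dim_subspace (label c) \<and> picture c \<in> pictures F (fseq.dim (label c))"

text \<open>The space \<open>W\<close> is arbitrary because removing the first card of a hand of
  \<open>std_space n\<close> leaves a hand of some complement, which need not be standard.\<close>

definition ordered_hands ::
  "(nat \<Rightarrow> ('a::field, 'p) card_pair set) \<Rightarrow> nat \<Rightarrow> 'a fseq set \<Rightarrow> ('a, 'p) card_pair list set"
  where "ordered_hands F k W = {cs. length cs = k \<and> distinct cs \<and>
    (\<forall>c\<in>set cs. family_card F c) \<and> direct_sum_decomp (set cs) label W}"

text \<open>Cards of \<open>F m\<close> have dimension \<open>m\<close> and relabeling preserves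
  dimension, so \<open>m\<close> can only be the dimension of the label.\<close>

lemma family_card_iff:
  assumes "q_exponential_family F"
  shows "family_card F c' \<longleftrightarrow> (\<exists>m\<ge>1. \<exists>c\<in>F m. relabeling c' c)"
proof
  assume "family_card F c'"
  then obtain c where c: "fseq.dim (label c') \<noteq> 0" "c \<in> F (fseq.dim (label c'))"
    "picture c' = picture c" and c': "is_card c'"
    by (auto simp: family_card_def pictures_def is_card_def split: if_splits)
  then have "standard_card c" "card_dim c = fseq.dim (label c')"
    using assms by (simp_all add: q_exponential_family_def q_deck_def Suc_le_eq)
  then have "relabeling c' c"
    using c c' by (simp add: relabeling_def standard_card_def card_dim_def)
  then show "\<exists>m\<ge>1. \<exists>c\<in>F m. relabeling c' c"
    using c by (intro exI[of _ "fseq.dim (label c')"]) auto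
next
  assume "\<exists>m\<ge>1. \<exists>c\<in>F m. relabeling c' c"
  then obtain m c where m: "m \<ge> 1" "c \<in> F m" "relabeling c' c" by blast
  then have "card_dim c = m"
    using assms by (auto simp: q_exponential_family_def q_deck_def)
  then show "family_card F c'"
    using m by (auto simp: family_card_def pictures_def relabeling_def is_card_def card_dim_def)
qed

section \<open>The recursion for ordered hands\<close>

lemma finite_card_pictures:
  assumes "q_exponential_family F"
  shows "finite (pictures F n)" "card (pictures F n) = (if n = 0 then 0 else card (F n))"
  using assms by (auto simp: pictures_def q_exponential_family_def q_deck_def card_image Suc_le_eq)

lemma ordered_hands_0:
  "ordered_hands F 0 W = (if W = {0} then {[]} else {})"
  by (auto simp: ordered_hands_def direct_sum_decomp_def bij_betw_def)

text \<open>Injectivity holds because the tail \<open>cs\<close> determines \<open>U\<close> as its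
  direct sum; surjectivity is \<open>direct_sum_decomp_insert\<close> applied to the label of the
  first card.\<close>

lemma bij_betw_ordered_hands_Suc:
  fixes W :: "'a::{finite, field} fseq set"
  assumes W: "finite_dim_subspace W"
  shows "bij_betw (\<lambda>((V, U), p, cs). (V, p) # cs)
    (SIGMA VU:splittings W. pictures F (fseq.dim (fst VU)) \<times> ordered_hands F k (snd VU))
    (ordered_hands F (Suc k) W)"
    (is "bij_betw ?f ?S _")
  unfolding bij_betw_def
proof
  show "inj_on ?f ?S"
  proof (rule inj_onI, clarsimp)
    fix U U' cs
    assume "cs \<in> ordered_hands F k U" "cs \<in> ordered_hands F k U'"
    then show "U = U'"
      unfolding ordered_hands_def using direct_sum_decomp_unique by blast
  qed
  show "?f ` ?S = ordered_hands F (Suc k) W"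
  proof (intro set_eqI iffI)
    fix ds assume "ds \<in> ?f ` ?S"
    then obtain V U p cs where VU: "(V, U) \<in> splittings W" and p: "p \<in> pictures F (fseq.dim V)"
      and cs: "cs \<in> ordered_hands F k U" and ds: "ds = (V, p) # cs"
      by auto
    \<comment> \<open>Cards of a hand have nonzero labels, so adding a card to a hand of a complement of its
      label cannot repeat a card.\<close>
    have "V \<noteq> {0}"
    proof
      assume "V = {0}"
      then have "fseq.dim V = 0"
        using fseq.dim_le_card[of V "{}"] by simp
      then show False
        using p by (simp add: pictures_def)
    qed
    then have "\<not> V \<subseteq> U"
      using VU by (auto simp: splittings_def)
    then have "(V, p) \<notin> set cs"
      using cs direct_sum_decomp_member_subset by (fastforce simp: ordered_hands_def)
    then show "ds \<in> ordered_hands F (Suc k) W"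
      using cs p ds VU dim_splitting(1)[OF W VU]
      by (auto simp: ordered_hands_def direct_sum_decomp_insert family_card_def)
  next
    fix ds assume "ds \<in> ordered_hands F (Suc k) W"
    then obtain V p cs where ds: "ds = (V, p) # cs" and
      *: "length cs = k" "distinct cs" "(V, p) \<notin> set cs" "\<forall>c\<in>set cs. family_card F c"
        "p \<in> pictures F (fseq.dim V)" "direct_sum_decomp (insert (V, p) (set cs)) label W"
      by (auto simp: ordered_hands_def length_Suc_conv family_card_def)
    then obtain U where "direct_sum_decomp (set cs) label U" "(V, U) \<in> splittings W"
      by (auto simp: direct_sum_decomp_insert)
    then show "ds \<in> ?f ` ?S"
      using ds * by (intro image_eqI[of _ _ "((V, U), p, cs)"]) (auto simp: ordered_hands_def)
  qed
qed

lemma dim_eq_0_iff: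
  fixes W :: "'a::{finite, field} fseq set"
  assumes "finite_dim_subspace W"
  shows "fseq.dim W = 0 \<longleftrightarrow> W = {0}"
proof
  assume "fseq.dim W = 0"
  then have "card W = 1"
    using finite_card_fin_dim[OF assms] by simp
  moreover have "0 \<in> W"
    using assms by (simp add: finite_dim_subspace_def fseq.subspace_0)
  ultimately show "W = {0}"
    by (auto simp: card_1_singleton_iff)
next
  assume "W = {0}"
  then show "fseq.dim W = 0"
    using fseq.dim_le_card[of W "{}"] by simp
qed

text \<open>Induction on \<open>k\<close> over all \<open>W\<close> at once, since the tail of a
  hand lives in an arbitrary complement. Grouping the splittings by the dimension of the first label
  turns the recursion into the Cauchy product of \<open>deck_enumerator F\<close> with its
  \<open>k\<close>-th power.\<close>

lemma finite_card_ordered_hands: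
  fixes F :: "nat \<Rightarrow> ('a::{finite, field}, 'p) card_pair set"
  assumes F: "q_exponential_family F" and "finite_dim_subspace W"
  shows "finite (ordered_hands F k W) \<and> of_nat (card (ordered_hands F k W)) =
    of_nat (GL_order CARD('a) (fseq.dim W)) * fps_nth (deck_enumerator F ^ k) (fseq.dim W)"
  using assms(2)
proof (induction k arbitrary: W)
  case 0
  \<comment> \<open>Both sides are 1 for the zero space, where \<open>GL_order\<close> is an empty
    product, and 0 for every other \<open>W\<close>.\<close>
  then show ?case
    using dim_eq_0_iff[OF 0] by (auto simp: ordered_hands_0 GL_order_def)
next
  case (Suc k)
  note W = Suc.prems
  let ?n = "fseq.dim W"
  let ?g = "\<lambda>n. of_nat (GL_order CARD('a) n) :: rat"
  let ?D = "deck_enumerator F"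
  let ?d = "\<lambda>m. of_nat (card (pictures F m)) :: rat"
  let ?S = "SIGMA VU:splittings W. pictures F (fseq.dim (fst VU)) \<times> ordered_hands F k (snd VU)"
  have g: "?g n \<noteq> 0" for n
    using GL_order_pos by simp
  have fin: "finite (pictures F (fseq.dim (fst VU)) \<times> ordered_hands F k (snd VU))"
    if "VU \<in> splittings W" for VU
    using that Suc.IH dim_splitting(2)[OF W] finite_card_pictures[OF F]
    by (metis finite_cartesian_product prod.collapse)
  have finS: "finite ?S"
    using finite_splittings[OF W] fin by (rule finite_SigmaI)
  note bij = bij_betw_ordered_hands_Suc[OF W, of F k]
  have "finite (ordered_hands F (Suc k) W)"
    using bij_betw_finite[OF bij] finS by simp
  moreover have "of_nat (card (ordered_hands F (Suc k) W)) = ?g ?n * fps_nth (?D ^ Suc k) ?n"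
  proof -
    have "card (ordered_hands F (Suc k) W) = card ?S"
      using bij_betw_same_card[OF bij] by simp
    also have "\<dots> = (\<Sum>VU\<in>splittings W.
        card (pictures F (fseq.dim (fst VU)) \<times> ordered_hands F k (snd VU)))"
      using finite_splittings[OF W] fin by (intro card_SigmaI) auto
    finally have "of_nat (card (ordered_hands F (Suc k) W)) = (\<Sum>VU\<in>splittings W.
        ?d (fseq.dim (fst VU)) * (of_nat (card (ordered_hands F k (snd VU))) :: rat))"
      by (simp add: card_cartesian_product)
    \<comment> \<open>Writing the dimension of \<open>U\<close> as a difference makes each term
      depend on the dimension of \<open>V\<close> alone, which permits the grouping that
      follows.\<close>
    also have "\<dots> = (\<Sum>VU\<in>splittings W. ?d (fseq.dim (fst VU)) *
        (?g (?n - fseq.dim (fst VU)) * fps_nth (?D ^ k) (?n - fseq.dim (fst VU))))"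
    proof (rule sum.cong[OF refl], clarify)
      fix V U assume VU: "(V, U) \<in> splittings W"
      note d = dim_splitting[OF W VU]
      have "fseq.dim U = ?n - fseq.dim V"
        using d(3) by simp
      then show "?d (fseq.dim (fst (V, U))) * of_nat (card (ordered_hands F k (snd (V, U)))) =
          ?d (fseq.dim (fst (V, U))) * (?g (?n - fseq.dim (fst (V, U))) *
            fps_nth (?D ^ k) (?n - fseq.dim (fst (V, U))))"
        using Suc.IH[OF d(2)] by simp
    qed
    also have "\<dots> = (\<Sum>m\<in>{0..?n}. \<Sum>VU\<in>{VU \<in> splittings W. fseq.dim (fst VU) = m}.
        ?d (fseq.dim (fst VU)) *
        (?g (?n - fseq.dim (fst VU)) * fps_nth (?D ^ k) (?n - fseq.dim (fst VU))))"
      using finite_splittings[OF W] dim_splitting(3)[OF W]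
      by (intro sum.group[symmetric]) (force intro: le_add1)+
    also have "\<dots> = (\<Sum>m=0..?n. of_nat (card {VU \<in> splittings W. fseq.dim (fst VU) = m}) *
        (?d m * (?g (?n - m) * fps_nth (?D ^ k) (?n - m))))"
      by (intro sum.cong refl) simp
    also have "\<dots> = (\<Sum>m=0..?n. ?g ?n * (fps_nth ?D m * fps_nth (?D ^ k) (?n - m)))"
    proof (rule sum.cong[OF refl])
      fix m assume m: "m \<in> {0..?n}"
      have "{VU \<in> splittings W. fseq.dim (fst VU) = m} = {(V, U) \<in> splittings W. fseq.dim V = m}"
        by auto
      \<comment> \<open>The number of splittings is \<open>?g ?n / (?g m * ?g (?n - m))\<close>: one
        denominator normalizes the deck, the other cancels the factor from the induction
        hypothesis.\<close>
      then have n: "?g ?n = of_nat (card {VU \<in> splittings W. fseq.dim (fst VU) = m}) *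
          (?g m * ?g (?n - m))"
        using card_splittings[OF W, of m] m by (simp flip: of_nat_mult)
      \<comment> \<open>For \<open>m = 0\<close> both sides are 0.\<close>
      have D: "fps_nth ?D m = ?d m / ?g m"
        by (simp add: deck_enumerator_def finite_card_pictures[OF F])
      show "of_nat (card {VU \<in> splittings W. fseq.dim (fst VU) = m}) *
          (?d m * (?g (?n - m) * fps_nth (?D ^ k) (?n - m))) =
          ?g ?n * (fps_nth ?D m * fps_nth (?D ^ k) (?n - m))"
        unfolding n D using g[of m] by simp
    qed
    also have "\<dots> = ?g ?n * fps_nth (?D ^ Suc k) ?n"
      by (simp add: fps_mult_nth sum_distrib_left)
    finally show ?thesis .
  qed
  ultimately show ?case by blast
qed


section \<open>The exponential formula\<close>

lemma finite_dim_std_space: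
  "finite_dim_subspace (std_space n :: 'a::field fseq set)"
  "fseq.dim (std_space n :: 'a fseq set) = n"
proof -
  let ?e = "\<lambda>i. Poly_Mapping.single i (1::'a)"
  show "finite_dim_subspace (std_space n :: 'a fseq set)"
    unfolding finite_dim_subspace_def std_space_def
    using fseq.subspace_span by blast
  have "fseq.independent (?e ` {..<n})"
  proof (induction n)
    case 0
    then show ?case by (simp add: fseq.independent_empty)
  next
    case (Suc n)
    \<comment> \<open>All earlier unit vectors vanish at position \<open>n\<close>, where
      \<open>?e n\<close> has entry 1.\<close>
    have "fseq.span (?e ` {..<n}) \<subseteq> {v. Poly_Mapping.lookup v n = 0}"
      by (rule fseq.span_minimal)
        (auto simp: fseq.subspace_def lookup_add lookup_single)
    then have "?e n \<notin> fseq.span (?e ` {..<n})"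
      by auto
    then show ?case
      using Suc by (simp add: lessThan_Suc fseq.independent_insertI)
  qed
  moreover have "inj_on ?e {..<n}"
    by (auto simp: inj_on_def dest: arg_cong[where f = Poly_Mapping.keys])
  ultimately show "fseq.dim (std_space n :: 'a fseq set) = n"
    unfolding std_space_def
    using fseq.dim_span_eq_card_independent by (fastforce simp: card_image)
qed

section \<open>From ordered hands to hands and to the exponential series\<close>

text \<open>A hand of \<open>k\<close> distinct cards has \<open>fact k\<close> orderings, and each
  ordering determines its hand as its set of entries, so the sets of orderings are disjoint.\<close>

lemma card_ordered_hands_std_space:
  fixes F :: "nat \<Rightarrow> ('a::{finite, field}, 'p) card_pair set"
  assumes F: "q_exponential_family F"
  shows "card (ordered_hands F k (std_space n)) = fact k * hand_count F n k"
proof -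
  let ?H = "{H. is_hand F n H \<and> card H = k}"
  have eq: "ordered_hands F k (std_space n) = (\<Union>H\<in>?H. permutations_of_set H)"
    by (auto simp: ordered_hands_def is_hand_def permutations_of_set_def
        family_card_iff[OF F] distinct_card)
  \<comment> \<open>The picture type may be infinite, so finiteness of the set of hands is drawn
    from that of the ordered hands.\<close>
  have "?H \<subseteq> set ` ordered_hands F k (std_space n)"
  proof
    fix H assume H: "H \<in> ?H"
    then obtain cs where "set cs = H" "distinct cs"
      using finite_distinct_list by (auto simp: is_hand_def)
    with H show "H \<in> set ` ordered_hands F k (std_space n)"
      unfolding eq by (force simp: permutations_of_set_def)
  qed
  moreover have "finite (ordered_hands F k (std_space n))"
    using finite_card_ordered_hands[OF F finite_dim_std_space(1)] by blast
  ultimately have fin: "finite ?H"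
    by (meson finite_surj)
  have "card (ordered_hands F k (std_space n)) = (\<Sum>H\<in>?H. card (permutations_of_set H))"
    unfolding eq using fin
    by (intro card_UN_disjoint) (auto dest: permutations_of_setD(1))
  also have "\<dots> = (\<Sum>H\<in>?H. fact k)"
    by (intro sum.cong) (auto simp: is_hand_def)
  finally show ?thesis
    by (simp add: hand_count_def)
qed

text \<open>Here \<open>fps_X\<close> is the outer variable y and \<open>D\<close> is constant in y,
  so the \<open>i\<close>-th power of their product lives only in y-degree \<open>i\<close>, and the
  composition leaves the single term \<open>i = k\<close>.\<close>

lemma fps_nth_bivariate_exp:
  "fps_nth (bivariate_exp (fps_X * fps_const D)) k = fps_const (1 / fact k) * D ^ k"
proof -
  have nth: "fps_nth ((fps_X * fps_const D) ^ i) k = (if k = i then D ^ i else 0)" for i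
    by (simp add: power_mult_distrib)
  show ?thesis
    unfolding bivariate_exp_def fps_compose_nth nth by (simp add: if_distrib cong: if_cong)
qed

theorem mainTheorem2:
  fixes F :: "nat \<Rightarrow> ('a::{finite, field}, 'p) card_pair set"
  assumes "q_exponential_family F"
  shows "hand_enumerator F = bivariate_exp (fps_X * fps_const (deck_enumerator F))"
proof (intro fps_ext)
  \<comment> \<open>\<open>k\<close> is the exponent of y and \<open>n\<close> that of x. Multiplied
    by \<open>fact k * ?g\<close>, the claimed equality of coefficients becomes the count of ordered
    hands of \<open>std_space n\<close>.\<close>
  fix k n
  let ?g = "of_nat (GL_order CARD('a) n) :: rat"
  have "?g \<noteq> 0"
    using GL_order_pos by simp
  moreover have "fact k * of_nat (hand_count F n k) = ?g * fps_nth (deck_enumerator F ^ k) n"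
    using finite_card_ordered_hands[OF assms finite_dim_std_space(1), of k n]
    by (simp add: card_ordered_hands_std_space[OF assms] finite_dim_std_space(2))
  ultimately show "fps_nth (fps_nth (hand_enumerator F) k) n =
      fps_nth (fps_nth (bivariate_exp (fps_X * fps_const (deck_enumerator F))) k) n"
    by (simp add: hand_enumerator_def fps_nth_bivariate_exp field_simps)
qed

end
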